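(* Let $Y\cong(\mathbb C^n,0)$, let $X\subseteq Y$ be a reduced Cohen--Macaulay germ of codimension $k\ge2$ and let $C\subseteq Y$ be a reduced complete intersection of codimension $k$ with $X\subseteq C$. Then $$\Omega^q(\log X/C)=\Sigma\Omega_Y^q:_{\Omega^q(\log C)}\mathcal I_X .$$ In other words, $\Omega^q(\log X/C)(-D)=\mathcal I_C\Omega_Y^q:_{\Omega^q(\log C)(-D)}\mathcal I_X$.
   Context: $Y$ is a germ of a smooth complex analytic space of dimension $n$, $\mathcal O_Y\cong\mathbb C\{x_1,\dots,x_n\}$, $\mathcal Q_Y$ its total ring of fractions, $\Omega_Y^q$ the free $\mathcal O_Y$-module of holomorphic differential $q$-forms. $\mathcal I_C\subseteq\mathcal I_X\subseteq\mathcal O_Y$ are the ideals of $C$ and $X$. Fix a regular sequence $h_1,\dots,h_k$ generating $\mathcal I_C$; $h=h_1\cdots h_k$, $D=\{h=0\}$. For an $\mathcal O_Y$-submodule $N$ of $\mathcal Q_Y\otimes\Omega_Y^q$, $N(D)=\frac1hN$ and $N(-D)=hN$. Put $\Sigma=\mathcal I_C(D)=\frac1h\mathcal I_C\subseteq\mathcal Q_Y$. Define $$\Omega^q(\log C)=\{\omega\in\Omega_Y^q(D)\mid dh_i\wedge\omega\in\Sigma\Omega_Y^{q+1}\text{ for }i=1,\dots,k\},$$ $$\Omega^q(\log X/C)=\{\omega\in\Omega_Y^q(D)\mid\mathcal I_X\omega\subseteq\Sigma\Omega_Y^q,\ d\mathcal I_X\wedge\omega\subseteq\Sigma\Omega_Y^{q+1}\}.$$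 For modules $A\subseteq B$ and an ideal $\mathfrak a$, $A:_B\mathfrak a=\{b\in B\mid\mathfrak a b\subseteq A\}$. *)

theory Defs
  imports
    "HOL-Analysis.Infinite_Sum"
    "HOL-Library.Function_Algebras"
    "HOL-Library.FuncSet"
    "HOL-Library.Cardinality"
    "HOL-Library.Extended_Nat"
    "HOL-Computational_Algebra.Fraction_Field"
begin

section \<open>The ring of convergent power series\<close>

text \<open>
  The coordinates \<open>x\<^sub>i\<close> of \<open>Y\<close> are indexed by a finite type \<open>'n\<close>, so \<open>n = CARD('n)\<close>;
  a multi-index is a function \<open>\<nu> :: 'n \<Rightarrow> nat\<close>.
\<close>

definition mdeg :: "('n::finite \<Rightarrow> nat) \<Rightarrow> nat"
  where "mdeg \<nu> = (\<Sum>i\<in>UNIV. \<nu> i)"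

text \<open>Absolute convergence on some closed polydisc \<open>{x. \<forall>i. \<bar>x\<^sub>i\<bar> \<le> r}\<close> with \<open>r > 0\<close>.\<close>

definition conv_series :: "(('n::finite \<Rightarrow> nat) \<Rightarrow> complex) \<Rightarrow> bool"
  where "conv_series a \<longleftrightarrow> (\<exists>r>0. (\<lambda>\<nu>. norm (a \<nu>) * r ^ mdeg \<nu>) summable_on UNIV)"

lemma mdeg_add: "mdeg (\<mu> + \<nu>) = mdeg \<mu> + mdeg \<nu>"
  by (simp add: mdeg_def sum.distrib)

lemma mdeg_diff: "\<alpha> \<le> \<nu> \<Longrightarrow> mdeg \<alpha> + mdeg (\<nu> - \<alpha>) = mdeg \<nu>"
  by (simp add: mdeg_def sum.distrib[symmetric] le_fun_def)

lemma mdeg_upd: "mdeg (\<nu>(i := Suc (\<nu> i))) = Suc (mdeg \<nu>)"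
proof -
  have "mdeg (\<nu>(i := Suc (\<nu> i))) = Suc (\<nu> i) + (\<Sum>j\<in>UNIV-{i}. \<nu> j)"
    by (simp add: mdeg_def sum.remove[of UNIV i])
  also have "\<dots> = Suc (mdeg \<nu>)"
    by (simp add: mdeg_def sum.remove[of UNIV i])
  finally show ?thesis .
qed

lemma le_mdeg: "\<nu> i \<le> mdeg \<nu>"
  unfolding mdeg_def by (rule member_le_sum) auto

lemma multi_le_eq_PiE: "{\<alpha>. \<alpha> \<le> \<nu>} = PiE UNIV (\<lambda>i. {..\<nu> i})"
  for \<nu> :: "'n::finite \<Rightarrow> nat"
  by (auto simp: le_fun_def PiE_def Pi_def)

lemma finite_multi_le [simp]: "finite {\<alpha>. \<alpha> \<le> \<nu>}"
  for \<nu> :: "'n::finite \<Rightarrow> nat"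
  unfolding multi_le_eq_PiE by (intro finite_PiE) auto

lemma card_multi_le: "card {\<alpha>. \<alpha> \<le> \<nu>} \<le> 2 ^ mdeg \<nu>"
  for \<nu> :: "'n::finite \<Rightarrow> nat"
proof -
  have "card {\<alpha>. \<alpha> \<le> \<nu>} = (\<Prod>i\<in>UNIV. Suc (\<nu> i))"
    unfolding multi_le_eq_PiE by (subst card_PiE) auto
  also have "\<dots> \<le> (\<Prod>i\<in>UNIV. 2 ^ \<nu> i)"
    by (intro prod_mono) (auto simp: Suc_leI)
  also have "\<dots> = 2 ^ mdeg \<nu>"
    by (simp add: mdeg_def power_sum)
  finally show ?thesis .
qed

lemma summable_geometric_multi:
  "(\<lambda>\<nu>::'n::finite \<Rightarrow> nat. (1/2::real) ^ mdeg \<nu>) summable_on UNIV"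
proof (rule nonneg_bdd_above_summable_on)
  show "bdd_above (sum (\<lambda>\<nu>::'n \<Rightarrow> nat. (1/2::real) ^ mdeg \<nu>) ` {F. F \<subseteq> UNIV \<and> finite F})"
  proof (rule bdd_aboveI2)
    fix F :: "('n \<Rightarrow> nat) set"
    assume "F \<in> {F. F \<subseteq> UNIV \<and> finite F}"
    then have F: "finite F" by simp
    obtain N where N: "\<And>\<nu>. \<nu> \<in> F \<Longrightarrow> mdeg \<nu> \<le> N"
      using finite_nat_set_iff_bounded_le[of "mdeg ` F"] F by auto
    have sub: "F \<subseteq> PiE UNIV (\<lambda>_. {..N})"
      using N le_mdeg by (fastforce intro: order_trans)
    have "sum (\<lambda>\<nu>. (1/2::real) ^ mdeg \<nu>) F \<le> sum (\<lambda>\<nu>. (1/2::real) ^ mdeg \<nu>) (PiE (UNIV::'n set) (\<lambda>_. {..N}))"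
      by (rule sum_mono2[OF finite_PiE sub]) auto
    also have "\<dots> = (\<Sum>\<nu>\<in>PiE (UNIV::'n set) (\<lambda>_. {..N}). \<Prod>i\<in>(UNIV::'n set). (1/2::real) ^ \<nu> i)"
      by (simp add: mdeg_def power_sum)
    also have "\<dots> = (\<Prod>i\<in>(UNIV::'n set). \<Sum>j\<le>N. (1/2::real) ^ j)"
      by (subst prod_sum_PiE) auto
    also have "\<dots> \<le> (\<Prod>i\<in>(UNIV::'n set). 2)"
    proof (intro prod_mono conjI sum_nonneg)
      show "(\<Sum>j\<le>N. (1/2::real) ^ j) \<le> 2"
      proof -
        have "(\<Sum>j\<le>N. (1/2::real) ^ j) = 2 - (1/2) ^ N"
          by (induction N) simp_all
        then show ?thesis by simp
      qed
    qed auto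
    finally show "sum (\<lambda>\<nu>. (1/2::real) ^ mdeg \<nu>) F \<le> 2 ^ CARD('n)" by simp
  qed
qed auto

lemma conv_series_iff_bound:
  "conv_series a \<longleftrightarrow> (\<exists>M R. R > 0 \<and> (\<forall>\<nu>. norm (a \<nu>) \<le> M * R ^ mdeg \<nu>))"
proof
  assume "conv_series a"
  then obtain r where r: "r > 0" and s: "(\<lambda>\<nu>. norm (a \<nu>) * r ^ mdeg \<nu>) summable_on UNIV"
    by (auto simp: conv_series_def)
  define M where "M = infsum (\<lambda>\<nu>. norm (a \<nu>) * r ^ mdeg \<nu>) UNIV"
  have "norm (a \<nu>) \<le> M * (1 / r) ^ mdeg \<nu>" for \<nu>
  proof -
    have "sum (\<lambda>\<nu>. norm (a \<nu>) * r ^ mdeg \<nu>) {\<nu>} \<le> M"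
      unfolding M_def using s r by (intro finite_sum_le_infsum) auto
    then show ?thesis using r by (simp add: field_simps)
  qed
  then show "\<exists>M R. R > 0 \<and> (\<forall>\<nu>. norm (a \<nu>) \<le> M * R ^ mdeg \<nu>)"
    using r by (intro exI[of _ M] exI[of _ "1 / r"]) auto
next
  assume "\<exists>M R. R > 0 \<and> (\<forall>\<nu>. norm (a \<nu>) \<le> M * R ^ mdeg \<nu>)"
  then obtain M R where R: "R > 0" and b: "\<And>\<nu>. norm (a \<nu>) \<le> M * R ^ mdeg \<nu>" by blast
  have "(\<lambda>\<nu>. norm (a \<nu>) * (1 / (2 * R)) ^ mdeg \<nu>) summable_on UNIV"
  proof (rule summable_on_comparison_test)
    show "(\<lambda>\<nu>. M * (1/2) ^ mdeg \<nu>) summable_on UNIV"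
      by (intro summable_on_cmult_right summable_geometric_multi)
    show "norm (a \<nu>) * (1 / (2 * R)) ^ mdeg \<nu> \<le> M * (1/2) ^ mdeg \<nu>" for \<nu>
    proof -
      have "norm (a \<nu>) * (1 / (2 * R)) ^ mdeg \<nu> \<le> M * R ^ mdeg \<nu> * (1 / (2 * R)) ^ mdeg \<nu>"
        using b R by (intro mult_right_mono) auto
      also have "\<dots> = M * (1/2) ^ mdeg \<nu>"
        using R by (simp add: power_mult_distrib[symmetric] mult.assoc)
      finally show ?thesis .
    qed
    show "0 \<le> norm (a \<nu>) * (1 / (2 * R)) ^ mdeg \<nu>" for \<nu>
      using R by auto
  qed
  then show "conv_series a"
    unfolding conv_series_def using R by (intro exI[of _ "1 / (2 * R)"]) auto
qed

lemma conv_seriesE2: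
  assumes "conv_series a" "conv_series b"
  obtains M N R where "R > 0" "M \<ge> 0" "N \<ge> 0"
    "\<And>\<nu>. norm (a \<nu>) \<le> M * R ^ mdeg \<nu>" "\<And>\<nu>. norm (b \<nu>) \<le> N * R ^ mdeg \<nu>"
proof -
  obtain M P where 1: "P > 0" "\<And>\<nu>. norm (a \<nu>) \<le> M * P ^ mdeg \<nu>"
    using assms(1) unfolding conv_series_iff_bound by blast
  obtain N Q where 2: "Q > 0" "\<And>\<nu>. norm (b \<nu>) \<le> N * Q ^ mdeg \<nu>"
    using assms(2) unfolding conv_series_iff_bound by blast
  have "norm (a \<nu>) \<le> \<bar>M\<bar> * (max P Q) ^ mdeg \<nu>" for \<nu>
    by (rule order_trans[OF 1(2)], rule mult_mono) (use 1 in \<open>auto intro!: power_mono\<close>)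
  moreover have "norm (b \<nu>) \<le> \<bar>N\<bar> * (max P Q) ^ mdeg \<nu>" for \<nu>
    by (rule order_trans[OF 2(2)], rule mult_mono) (use 2 1 in \<open>auto intro!: power_mono\<close>)
  ultimately show ?thesis
    by (intro that[of "max P Q" "\<bar>M\<bar>" "\<bar>N\<bar>"]) (use 1(1) in simp_all)
qed

lemma conv_series_finite_support:
  assumes "\<And>\<nu>. \<nu> \<noteq> 0 \<Longrightarrow> a \<nu> = 0"
  shows "conv_series a"
proof -
  have "norm (a \<nu>) \<le> norm (a 0) * 1 ^ mdeg \<nu>" for \<nu>
    using assms[of \<nu>] by (cases "\<nu> = 0") simp_all
  then show ?thesis
    unfolding conv_series_iff_bound using zero_less_one by blast
qed

lemma conv_series_uminus: "conv_series a \<Longrightarrow> conv_series (\<lambda>\<nu>. - a \<nu>)"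
  by (simp add: conv_series_def)

lemma conv_series_add:
  assumes "conv_series a" "conv_series b"
  shows "conv_series (\<lambda>\<nu>. a \<nu> + b \<nu>)"
proof -
  obtain M N R where *: "R > 0" "M \<ge> 0" "N \<ge> 0"
    "\<And>\<nu>. norm (a \<nu>) \<le> M * R ^ mdeg \<nu>" "\<And>\<nu>. norm (b \<nu>) \<le> N * R ^ mdeg \<nu>"
    by (rule conv_seriesE2[OF assms]) (rule that)
  have "norm (a \<nu> + b \<nu>) \<le> (M + N) * R ^ mdeg \<nu>" for \<nu>
    using norm_triangle_ineq[of "a \<nu>" "b \<nu>"] *(4,5)[of \<nu>] by (simp add: algebra_simps)
  then show ?thesis unfolding conv_series_iff_bound using *(1) by blast
qed

lemma conv_series_mult:
  assumes "conv_series a" "conv_series b"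
  shows "conv_series (\<lambda>\<nu>. \<Sum>\<alpha> | \<alpha> \<le> \<nu>. a \<alpha> * b (\<nu> - \<alpha>))"
proof -
  obtain M N R where *: "R > 0" "M \<ge> 0" "N \<ge> 0"
    "\<And>\<nu>. norm (a \<nu>) \<le> M * R ^ mdeg \<nu>" "\<And>\<nu>. norm (b \<nu>) \<le> N * R ^ mdeg \<nu>"
    by (rule conv_seriesE2[OF assms]) (rule that)
  have "norm (\<Sum>\<alpha> | \<alpha> \<le> \<nu>. a \<alpha> * b (\<nu> - \<alpha>)) \<le> (M * N) * (2 * R) ^ mdeg \<nu>" for \<nu>
  proof -
    have "norm (\<Sum>\<alpha> | \<alpha> \<le> \<nu>. a \<alpha> * b (\<nu> - \<alpha>)) \<le> (\<Sum>\<alpha> | \<alpha> \<le> \<nu>. M * N * R ^ mdeg \<nu>)"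
    proof (rule sum_norm_le)
      fix \<alpha> assume "\<alpha> \<in> {\<alpha>. \<alpha> \<le> \<nu>}"
      then have le: "\<alpha> \<le> \<nu>" by simp
      have "norm (a \<alpha> * b (\<nu> - \<alpha>)) \<le> (M * R ^ mdeg \<alpha>) * (N * R ^ mdeg (\<nu> - \<alpha>))"
        unfolding norm_mult using * by (intro mult_mono) auto
      also have "\<dots> = M * N * R ^ (mdeg \<alpha> + mdeg (\<nu> - \<alpha>))"
        by (simp add: power_add)
      finally show "norm (a \<alpha> * b (\<nu> - \<alpha>)) \<le> M * N * R ^ mdeg \<nu>"
        by (simp add: mdeg_diff[OF le])
    qed
    also have "\<dots> = real (card {\<alpha>. \<alpha> \<le> \<nu>}) * (M * N * R ^ mdeg \<nu>)" by simp
    also have "\<dots> \<le> real (2 ^ mdeg \<nu>) * (M * N * R ^ mdeg \<nu>)"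
      using card_multi_le[of \<nu>] * by (intro mult_right_mono) (auto simp del: of_nat_power)
    also have "\<dots> = (M * N) * (2 * R) ^ mdeg \<nu>"
      by (simp add: power_mult_distrib)
    finally show ?thesis .
  qed
  then show ?thesis unfolding conv_series_iff_bound using *(1)
    by (intro exI[of _ "M * N"] exI[of _ "2 * R"]) auto
qed

lemma conv_series_partial:
  assumes "conv_series a"
  shows "conv_series (\<lambda>\<nu>. of_nat (Suc (\<nu> i)) * a (\<nu>(i := Suc (\<nu> i))))"
proof -
  obtain M R where *: "R > 0" "M \<ge> 0" "\<And>\<nu>. norm (a \<nu>) \<le> M * R ^ mdeg \<nu>"
    by (rule conv_seriesE2[OF assms assms]) (rule that)
  have "norm (of_nat (Suc (\<nu> i)) * a (\<nu>(i := Suc (\<nu> i)))) \<le> (M * R) * (2 * R) ^ mdeg \<nu>" for \<nu>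
  proof -
    have "Suc (\<nu> i) \<le> 2 ^ mdeg \<nu>"
      using le_mdeg[of \<nu> i] less_exp[of "mdeg \<nu>"] by linarith
    then have le: "real (Suc (\<nu> i)) \<le> 2 ^ mdeg \<nu>"
      by (metis of_nat_le_iff of_nat_numeral of_nat_power)
    have "norm (of_nat (Suc (\<nu> i)) * a (\<nu>(i := Suc (\<nu> i)))) \<le> 2 ^ mdeg \<nu> * (M * R ^ mdeg (\<nu>(i := Suc (\<nu> i))))"
      unfolding norm_mult norm_of_nat using * le by (intro mult_mono) auto
    then show ?thesis by (simp add: mdeg_upd power_mult_distrib mult_ac)
  qed
  then show ?thesis unfolding conv_series_iff_bound using *(1)
    by (intro exI[of _ "M * R"] exI[of _ "2 * R"]) auto
qed

text \<open>\<open>'n holo_germ\<close> is \<open>\<O>\<^sub>Y \<cong> \<complex>{x\<^sub>1, \<dots>, x\<^sub>n}\<close>.\<close>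

typedef 'n holo_germ = "{a :: ('n::finite \<Rightarrow> nat) \<Rightarrow> complex. conv_series a}"
  morphisms germ_coeff Abs_holo_germ
  by (rule exI[of _ "\<lambda>_. 0"]) (simp add: conv_series_finite_support)

setup_lifting type_definition_holo_germ

lemma holo_germ_eqI: "(\<And>\<nu>. germ_coeff f \<nu> = germ_coeff g \<nu>) \<Longrightarrow> f = g"
  by (simp add: germ_coeff_inject[symmetric] fun_eq_iff)

instantiation holo_germ :: (finite) comm_ring_1
begin

lift_definition zero_holo_germ :: "'a holo_germ" is "\<lambda>_. 0"
  by (simp add: conv_series_finite_support)

lift_definition one_holo_germ :: "'a holo_germ" is "\<lambda>\<nu>. if \<nu> = 0 then 1 else 0"
  by (simp add: conv_series_finite_support)

lift_definition plus_holo_germ :: "'a holo_germ \<Rightarrow> 'a holo_germ \<Rightarrow> 'a holo_germ"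
  is "\<lambda>a b \<nu>. a \<nu> + b \<nu>"
  by (rule conv_series_add)

lift_definition uminus_holo_germ :: "'a holo_germ \<Rightarrow> 'a holo_germ"
  is "\<lambda>a \<nu>. - a \<nu>"
  by (rule conv_series_uminus)

lift_definition minus_holo_germ :: "'a holo_germ \<Rightarrow> 'a holo_germ \<Rightarrow> 'a holo_germ"
  is "\<lambda>a b \<nu>. a \<nu> - b \<nu>"
  using conv_series_add[OF _ conv_series_uminus] by simp

lift_definition times_holo_germ :: "'a holo_germ \<Rightarrow> 'a holo_germ \<Rightarrow> 'a holo_germ"
  is "\<lambda>a b \<nu>. \<Sum>\<alpha> | \<alpha> \<le> \<nu>. a \<alpha> * b (\<nu> - \<alpha>)"
  by (rule conv_series_mult)

instance
proof
  fix f g h :: "'a holo_germ"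
  show "f + g + h = f + (g + h)" by transfer (simp add: add.assoc)
  show "f + g = g + f" by transfer (simp add: add.commute)
  show "0 + f = f" by transfer simp
  show "- f + f = 0" by transfer simp
  show "f - g = f + - g" by transfer simp
  show "(f + g) * h = f * h + g * h"
    by transfer (simp add: sum.distrib distrib_right)
  show "(0::'a holo_germ) \<noteq> 1" by transfer (auto simp: fun_eq_iff)
  show "f * g = g * f"
  proof (transfer, rule ext)
    fix a b :: "('a \<Rightarrow> nat) \<Rightarrow> complex" and \<nu>
    show "(\<Sum>\<alpha> | \<alpha> \<le> \<nu>. a \<alpha> * b (\<nu> - \<alpha>)) = (\<Sum>\<alpha> | \<alpha> \<le> \<nu>. b \<alpha> * a (\<nu> - \<alpha>))"
    proof (rule sum.reindex_bij_witness[of _ "\<lambda>\<alpha>. \<nu> - \<alpha>" "\<lambda>\<alpha>. \<nu> - \<alpha>"], goal_cases)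
      case (5 \<alpha>)
      then have "\<nu> - (\<nu> - \<alpha>) = \<alpha>" by (auto simp: le_fun_def fun_eq_iff)
      then show ?case by simp
    qed (auto simp: le_fun_def fun_eq_iff)
  qed
  show "1 * f = f"
  proof (transfer, rule ext)
    fix a :: "('a \<Rightarrow> nat) \<Rightarrow> complex" and \<nu>
    have "(\<Sum>\<alpha> | \<alpha> \<le> \<nu>. (if \<alpha> = 0 then 1 else 0) * a (\<nu> - \<alpha>))
        = (\<Sum>\<alpha> | \<alpha> \<le> \<nu>. if \<alpha> = 0 then a \<nu> else 0)"
    proof (rule sum.cong[OF refl])
      fix \<alpha>
      have "\<nu> - 0 = \<nu>" by (simp add: fun_eq_iff)
      then show "(if \<alpha> = 0 then 1 else 0) * a (\<nu> - \<alpha>) = (if \<alpha> = 0 then a \<nu> else 0)" by simp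
    qed
    also have "\<dots> = a \<nu>" by (subst sum.delta[OF finite_multi_le]) (auto simp: le_fun_def)
    finally show "(\<Sum>\<alpha> | \<alpha> \<le> \<nu>. (if \<alpha> = 0 then 1 else 0) * a (\<nu> - \<alpha>)) = a \<nu>" .
  qed
  show "f * g * h = f * (g * h)"
  proof (transfer, rule ext)
    fix a b c :: "('a \<Rightarrow> nat) \<Rightarrow> complex" and \<nu>
    have "(\<Sum>\<alpha> | \<alpha> \<le> \<nu>. (\<Sum>\<beta> | \<beta> \<le> \<alpha>. a \<beta> * b (\<alpha> - \<beta>)) * c (\<nu> - \<alpha>))
        = (\<Sum>(\<alpha>, \<beta>) \<in> (SIGMA \<alpha>:{\<alpha>. \<alpha> \<le> \<nu>}. {\<beta>. \<beta> \<le> \<alpha>}). a \<beta> * b (\<alpha> - \<beta>) * c (\<nu> - \<alpha>))"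
      by (subst sum.Sigma[symmetric]) (auto simp: sum_distrib_right)
    also have "\<dots> = (\<Sum>(\<beta>, \<gamma>) \<in> (SIGMA \<beta>:{\<beta>. \<beta> \<le> \<nu>}. {\<gamma>. \<gamma> \<le> \<nu> - \<beta>}). a \<beta> * b \<gamma> * c (\<nu> - \<beta> - \<gamma>))"
    proof (rule sum.reindex_bij_witness[of _ "\<lambda>(\<beta>, \<gamma>). (\<beta> + \<gamma>, \<beta>)" "\<lambda>(\<alpha>, \<beta>). (\<beta>, \<alpha> - \<beta>)"], goal_cases)
      case (1 p)
      then show ?case by (auto simp: le_fun_def fun_eq_iff)
    next
      case (2 p)
      then show ?case
        by (cases p) (auto simp: le_fun_def intro: diff_le_mono order_trans)
    next
      case (3 p)
      then show ?case by (auto simp: le_fun_def fun_eq_iff)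
    next
      case (4 p)
      obtain \<beta> \<gamma> where p: "p = (\<beta>, \<gamma>)" by (cases p)
      have "\<beta> x + \<gamma> x \<le> \<nu> x" for x
      proof -
        have "\<beta> x \<le> \<nu> x" "\<gamma> x \<le> \<nu> x - \<beta> x" using 4 by (auto simp: p le_fun_def)
        then show ?thesis by linarith
      qed
      then show ?case by (auto simp: p le_fun_def)
    next
      case (5 p)
      obtain \<alpha> \<beta> where p: "p = (\<alpha>, \<beta>)" by (cases p)
      have "\<nu> - \<beta> - (\<alpha> - \<beta>) = \<nu> - \<alpha>"
      proof
        fix x
        have "\<beta> x \<le> \<alpha> x" "\<alpha> x \<le> \<nu> x" using 5 by (auto simp: p le_fun_def)
        then show "(\<nu> - \<beta> - (\<alpha> - \<beta>)) x = (\<nu> - \<alpha>) x" by simp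
      qed
      then show ?case by (simp add: p)
    qed
    also have "\<dots> = (\<Sum>\<beta> | \<beta> \<le> \<nu>. a \<beta> * (\<Sum>\<gamma> | \<gamma> \<le> \<nu> - \<beta>. b \<gamma> * c (\<nu> - \<beta> - \<gamma>)))"
      by (subst sum.Sigma[symmetric]) (auto simp: sum_distrib_left mult.assoc)
    finally show "(\<Sum>\<alpha> | \<alpha> \<le> \<nu>. (\<Sum>\<beta> | \<beta> \<le> \<alpha>. a \<beta> * b (\<alpha> - \<beta>)) * c (\<nu> - \<alpha>))
      = (\<Sum>\<alpha> | \<alpha> \<le> \<nu>. a \<alpha> * (\<Sum>\<beta> | \<beta> \<le> \<nu> - \<alpha>. b \<beta> * c (\<nu> - \<alpha> - \<beta>)))" .
  qed
qed

end

text \<open>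
  Absence of zero divisors: order the multi-indices by total degree and then by the value of a
  base-\<open>B\<close> expansion (Kronecker substitution), and multiply the lowest terms.
\<close>

lemma base_expansion_inj:
  fixes u v :: "nat \<Rightarrow> nat"
  assumes "\<And>i. i < n \<Longrightarrow> u i < B" "\<And>i. i < n \<Longrightarrow> v i < B"
    and "(\<Sum>i<n. u i * B ^ i) = (\<Sum>i<n. v i * B ^ i)" "i < n"
  shows "u i = v i"
  using assms
proof (induction n arbitrary: u v i)
  case (Suc n)
  have split: "(\<Sum>i<Suc n. w i * B ^ i) = w 0 + B * (\<Sum>i<n. w (Suc i) * B ^ i)" for w :: "nat \<Rightarrow> nat"
    by (simp only: sum.lessThan_Suc_shift) (simp add: sum_distrib_left mult_ac)
  have lt: "u 0 < B" "v 0 < B" using Suc.prems(1,2) by auto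
  have eq: "u 0 + B * (\<Sum>i<n. u (Suc i) * B ^ i) = v 0 + B * (\<Sum>i<n. v (Suc i) * B ^ i)"
    using Suc.prems(3) unfolding split .
  have 0: "u 0 = v 0"
    using arg_cong[OF eq, of "\<lambda>x. x mod B"] lt by simp
  have "(\<Sum>i<n. u (Suc i) * B ^ i) = (\<Sum>i<n. v (Suc i) * B ^ i)"
    using eq 0 lt by simp
  then have "i < n \<Longrightarrow> u (Suc i) = v (Suc i)" for i
    by (intro Suc.IH[of "\<lambda>i. u (Suc i)" "\<lambda>i. v (Suc i)"]) (use Suc.prems(1,2) in auto)
  with 0 Suc.prems(4) show ?case by (cases i) auto
qed simp

lemma obtain_lex_least:
  fixes S :: "('n::finite \<Rightarrow> nat) set" and w :: "('n \<Rightarrow> nat) \<Rightarrow> nat"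
  assumes "\<nu> \<in> S" "\<And>\<alpha>. \<alpha> \<in> S \<Longrightarrow> mdeg \<nu> \<le> mdeg \<alpha>"
  obtains \<mu> where "\<mu> \<in> S" "mdeg \<mu> = mdeg \<nu>"
    "\<And>\<alpha>. \<alpha> \<in> S \<Longrightarrow> mdeg \<mu> \<le> mdeg \<alpha>"
    "\<And>\<alpha>. \<alpha> \<in> S \<Longrightarrow> mdeg \<alpha> = mdeg \<mu> \<Longrightarrow> w \<mu> \<le> w \<alpha>"
proof -
  define P where "P \<mu> \<longleftrightarrow> \<mu> \<in> S \<and> mdeg \<mu> = mdeg \<nu>" for \<mu>
  have "P \<nu>" using assms by (simp add: P_def)
  then obtain \<mu> where "P \<mu>" "\<And>\<alpha>. P \<alpha> \<Longrightarrow> w \<mu> \<le> w \<alpha>"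
    using ex_has_least_nat[of P \<nu> w] by blast
  then show ?thesis
    using that[of \<mu>] assms(2) unfolding P_def by auto
qed

lemma holo_germ_no_zero_divisors:
  fixes f g :: "'n::finite holo_germ"
  assumes "f \<noteq> 0" "g \<noteq> 0"
  shows "f * g \<noteq> 0"
proof -
  define F where "F = {\<nu>. germ_coeff f \<nu> \<noteq> 0}"
  define G where "G = {\<nu>. germ_coeff g \<nu> \<noteq> 0}"
  have "\<exists>\<nu>. \<nu> \<in> F" "\<exists>\<nu>. \<nu> \<in> G"
    using assms holo_germ_eqI[of f 0] holo_germ_eqI[of g 0]
    by (auto simp: F_def G_def zero_holo_germ.rep_eq)
  then obtain \<nu>0 \<mu>0 where \<nu>0: "\<nu>0 \<in> F" "\<And>\<alpha>. \<alpha> \<in> F \<Longrightarrow> mdeg \<nu>0 \<le> mdeg \<alpha>"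
    and \<mu>0: "\<mu>0 \<in> G" "\<And>\<alpha>. \<alpha> \<in> G \<Longrightarrow> mdeg \<mu>0 \<le> mdeg \<alpha>"
    using ex_has_least_nat[of "\<lambda>\<nu>. \<nu> \<in> F" _ mdeg] ex_has_least_nat[of "\<lambda>\<nu>. \<nu> \<in> G" _ mdeg] by metis
  define B where "B = Suc (mdeg \<nu>0 + mdeg \<mu>0)"
  obtain e :: "nat \<Rightarrow> 'n" where e: "bij_betw e {..<CARD('n)} UNIV"
    using ex_bij_betw_nat_finite[of "UNIV :: 'n set"] by (auto simp: atLeast0LessThan)
  define w :: "('n \<Rightarrow> nat) \<Rightarrow> nat" where "w \<alpha> = (\<Sum>i<CARD('n). \<alpha> (e i) * B ^ i)" for \<alpha>
  have w_add: "w (\<alpha> + \<beta>) = w \<alpha> + w \<beta>" for \<alpha> \<beta>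
    by (simp add: w_def sum.distrib distrib_right)
  have w_inj: "\<alpha> = \<beta>" if "w \<alpha> = w \<beta>" "mdeg \<alpha> < B" "mdeg \<beta> < B" for \<alpha> \<beta>
  proof
    fix x
    have "x \<in> e ` {..<CARD('n)}" using e by (simp add: bij_betw_def)
    then obtain i where i: "i < CARD('n)" "x = e i" by auto
    have "\<alpha> (e i) = \<beta> (e i)"
      by (rule base_expansion_inj[of "CARD('n)" "\<lambda>i. \<alpha> (e i)" B "\<lambda>i. \<beta> (e i)"])
        (use that i le_mdeg in \<open>auto simp: w_def intro: le_less_trans\<close>)
    then show "\<alpha> x = \<beta> x" using i by simp
  qed
  obtain \<nu> where \<nu>: "\<nu> \<in> F" "mdeg \<nu> = mdeg \<nu>0" "\<And>\<alpha>. \<alpha> \<in> F \<Longrightarrow> mdeg \<nu> \<le> mdeg \<alpha>"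
    "\<And>\<alpha>. \<alpha> \<in> F \<Longrightarrow> mdeg \<alpha> = mdeg \<nu> \<Longrightarrow> w \<nu> \<le> w \<alpha>"
    by (rule obtain_lex_least[OF \<nu>0, of w]) (assumption | rule that)+
  obtain \<mu> where \<mu>: "\<mu> \<in> G" "mdeg \<mu> = mdeg \<mu>0" "\<And>\<alpha>. \<alpha> \<in> G \<Longrightarrow> mdeg \<mu> \<le> mdeg \<alpha>"
    "\<And>\<alpha>. \<alpha> \<in> G \<Longrightarrow> mdeg \<alpha> = mdeg \<mu> \<Longrightarrow> w \<mu> \<le> w \<alpha>"
    by (rule obtain_lex_least[OF \<mu>0, of w]) (assumption | rule that)+
  have zero: "germ_coeff f \<alpha> * germ_coeff g (\<nu> + \<mu> - \<alpha>) = 0" if "\<alpha> \<le> \<nu> + \<mu>" "\<alpha> \<noteq> \<nu>" for \<alpha>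
  proof (rule ccontr)
    define \<beta> where "\<beta> = \<nu> + \<mu> - \<alpha>"
    assume "germ_coeff f \<alpha> * germ_coeff g (\<nu> + \<mu> - \<alpha>) \<noteq> 0"
    then have in_supp: "\<alpha> \<in> F" "\<beta> \<in> G" by (auto simp: F_def G_def \<beta>_def)
    have "\<alpha> + \<beta> = \<nu> + \<mu>" using that(1) by (auto simp: \<beta>_def fun_eq_iff le_fun_def)
    then have sums: "mdeg \<alpha> + mdeg \<beta> = mdeg \<nu> + mdeg \<mu>" "w \<alpha> + w \<beta> = w \<nu> + w \<mu>"
      by (metis mdeg_add, metis w_add)
    have degs: "mdeg \<alpha> = mdeg \<nu>" "mdeg \<beta> = mdeg \<mu>"
      using sums(1) \<nu>(3)[OF in_supp(1)] \<mu>(3)[OF in_supp(2)] by auto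
    have "w \<alpha> = w \<nu>"
      using sums(2) \<nu>(4)[OF in_supp(1) degs(1)] \<mu>(4)[OF in_supp(2) degs(2)] by auto
    then have "\<alpha> = \<nu>" by (rule w_inj) (auto simp: degs \<nu>(2) B_def)
    with that(2) show False by simp
  qed
  have "germ_coeff (f * g) (\<nu> + \<mu>) = (\<Sum>\<alpha> | \<alpha> \<le> \<nu> + \<mu>. germ_coeff f \<alpha> * germ_coeff g (\<nu> + \<mu> - \<alpha>))"
    by (simp add: times_holo_germ.rep_eq)
  also have "\<dots> = germ_coeff f \<nu> * germ_coeff g (\<nu> + \<mu> - \<nu>)"
    by (subst sum.remove[OF finite_multi_le, of \<nu>]) (auto simp: le_fun_def zero intro!: sum.neutral)
  also have "\<dots> = germ_coeff f \<nu> * germ_coeff g \<mu>" by simp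
  also have "\<dots> \<noteq> 0" using \<nu>(1) \<mu>(1) by (simp add: F_def G_def)
  finally show ?thesis by (auto simp: zero_holo_germ.rep_eq)
qed

instance holo_germ :: (finite) idom
  by standard (rule holo_germ_no_zero_divisors)

lift_definition germ_partial :: "'n::finite \<Rightarrow> 'n holo_germ \<Rightarrow> 'n holo_germ"
  is "\<lambda>i a \<nu>. of_nat (Suc (\<nu> i)) * a (\<nu>(i := Suc (\<nu> i)))"
  by (rule conv_series_partial)

definition germ_max_ideal :: "'n::finite holo_germ set"
  where "germ_max_ideal = {f. germ_coeff f 0 = 0}"


section \<open>Commutative algebra\<close>

text \<open>Ideals are the submodules of the ring over itself; \<open>ring_ideal.span A\<close> is the ideal
  generated by \<open>A\<close>.\<close>

interpretation ring_ideal: module "(*) :: 'a::comm_ring_1 \<Rightarrow> 'a \<Rightarrow> 'a"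
  by standard (simp_all add: algebra_simps)

lemmas [simp del] = ring_ideal.scale_scale

abbreviation is_ideal :: "'a::comm_ring_1 set \<Rightarrow> bool"
  where "is_ideal \<equiv> ring_ideal.subspace"

abbreviation ideal_gen :: "'a::comm_ring_1 set \<Rightarrow> 'a set"
  where "ideal_gen \<equiv> ring_ideal.span"

definition prime_ideal :: "'a::comm_ring_1 set \<Rightarrow> bool"
  where "prime_ideal P \<longleftrightarrow>
    is_ideal P \<and> P \<noteq> UNIV \<and> (\<forall>a b. a * b \<in> P \<longrightarrow> a \<in> P \<or> b \<in> P)"

text \<open>Krull dimension of the quotient ring \<open>R/I\<close>; its primes are the primes of \<open>R\<close> containing \<open>I\<close>.\<close>

definition krull_dim_quot :: "'a::comm_ring_1 set \<Rightarrow> enat"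
  where "krull_dim_quot I = Sup {enat m | m. \<exists>P.
    (\<forall>i\<le>m. prime_ideal (P i) \<and> I \<subseteq> P i) \<and> (\<forall>i<m. P i \<subset> P (Suc i))}"

text \<open>\<open>f\<^sub>1, \<dots>, f\<^sub>r\<close> is a regular sequence on \<open>R/I\<close>: \<open>f\<^bsub>i+1\<^esub>\<close> is a nonzerodivisor on
  \<open>R/(I + (f\<^sub>1, \<dots>, f\<^sub>i))\<close>, and \<open>R/(I + (f\<^sub>1, \<dots>, f\<^sub>r))\<close> is not zero.\<close>

definition regular_seq_quot :: "'a::comm_ring_1 set \<Rightarrow> 'a list \<Rightarrow> bool"
  where "regular_seq_quot I fs \<longleftrightarrow>
    (\<forall>i<length fs. \<forall>g. fs ! i * g \<in> ideal_gen (I \<union> set (take i fs))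
        \<longrightarrow> g \<in> ideal_gen (I \<union> set (take i fs))) \<and>
    ideal_gen (I \<union> set fs) \<noteq> UNIV"

definition regular_seq :: "'a::comm_ring_1 list \<Rightarrow> bool"
  where "regular_seq fs \<longleftrightarrow> regular_seq_quot {0} fs"


section \<open>Germs of complex spaces\<close>

text \<open>A (nonempty) closed subgerm \<open>X \<subseteq> Y\<close> is given by its ideal \<open>I = \<I>\<^sub>X\<close>, a proper ideal, with
  \<open>\<O>\<^sub>X = \<O>\<^sub>Y/I\<close>. It is reduced if \<open>\<O>\<^sub>X\<close> has no nilpotents.\<close>

definition is_germ :: "'n::finite holo_germ set \<Rightarrow> bool"
  where "is_germ I \<longleftrightarrow> is_ideal I \<and> I \<noteq> UNIV"

definition reduced_germ :: "'n::finite holo_germ set \<Rightarrow> bool"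
  where "reduced_germ I \<longleftrightarrow> is_germ I \<and> (\<forall>f m. f ^ m \<in> I \<longrightarrow> f \<in> I)"

definition germ_codim :: "'n::finite holo_germ set \<Rightarrow> enat"
  where "germ_codim I = enat CARD('n) - krull_dim_quot I"

definition germ_depth :: "'n::finite holo_germ set \<Rightarrow> enat"
  where "germ_depth I =
    Sup {enat (length fs) | fs. set fs \<subseteq> germ_max_ideal \<and> regular_seq_quot I fs}"

definition cohen_macaulay_germ :: "'n::finite holo_germ set \<Rightarrow> bool"
  where "cohen_macaulay_germ I \<longleftrightarrow> is_germ I \<and> germ_depth I = krull_dim_quot I"


section \<open>Meromorphic differential forms\<close>

text \<open>
  Since \<open>\<O>\<^sub>Y\<close> is a domain, \<open>\<Q>\<^sub>Y\<close> is its field of fractions \<open>'n holo_germ fract\<close>.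
  A form \<open>\<Sum>\<^sub>I \<omega>\<^sub>I dx\<^sub>I\<close> with coefficients in \<open>\<Q>\<^sub>Y\<close> is the family \<open>I \<mapsto> \<omega>\<^sub>I\<close>, where
  \<open>dx\<^sub>I = dx\<^bsub>i1\<^esub> \<and> \<dots> \<and> dx\<^bsub>iq\<^esub>\<close> for \<open>I = {i1 < \<dots> < iq}\<close>; this is where the linear order on
  the index type is used.
\<close>

type_synonym 'n mero = "'n holo_germ fract"
type_synonym 'n mform = "'n set \<Rightarrow> 'n mero"

definition mero_of :: "'n::finite holo_germ \<Rightarrow> 'n mero"
  where "mero_of f = Fraction_Field.Fract f 1"

definition fscale :: "'n::finite mero \<Rightarrow> 'n mform \<Rightarrow> 'n mform"
  where "fscale c \<omega> = (\<lambda>I. c * \<omega> I)"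

definition dx :: "'n set \<Rightarrow> 'n::finite mform"
  where "dx J = (\<lambda>I. if I = J then 1 else 0)"

definition d_germ :: "'n::finite holo_germ \<Rightarrow> 'n mform"
  where "d_germ f = (\<Sum>i\<in>UNIV. fscale (mero_of (germ_partial i f)) (dx {i}))"

text \<open>\<open>dx\<^sub>I \<and> dx\<^sub>J = \<epsilon>(I, J) dx\<^bsub>I \<union> J\<^esub>\<close> for disjoint \<open>I\<close>, \<open>J\<close>, where \<open>\<epsilon>(I, J)\<close> is \<open>-1\<close> to
  the number of inversions.\<close>

definition wedge_sign :: "'n::linorder set \<Rightarrow> 'n set \<Rightarrow> 'a::comm_ring_1"
  where "wedge_sign I J = (-1) ^ card {(i, j). i \<in> I \<and> j \<in> J \<and> j < i}"

definition wedge :: "'n::{finite,linorder} mform \<Rightarrow> 'n mform \<Rightarrow> 'n mform"  (infixr "\<and>\<^sub>f" 70)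
  where "\<alpha> \<and>\<^sub>f \<beta> = (\<lambda>K. \<Sum>I\<in>Pow K. wedge_sign I (K - I) * \<alpha> I * \<beta> (K - I))"

definition holo_forms :: "nat \<Rightarrow> 'n::finite mform set"
  where "holo_forms q =
    {\<omega>. \<forall>I. \<omega> I \<in> range mero_of \<and> (card I \<noteq> q \<longrightarrow> \<omega> I = 0)}"

text \<open>\<open>twist g N = gN\<close>; thus \<open>N(D)\<close> is \<open>twist (1/h) N\<close> and \<open>N(-D)\<close> is \<open>twist h N\<close>.\<close>

definition twist :: "'n::finite mero \<Rightarrow> 'n mform set \<Rightarrow> 'n mform set"
  where "twist g N = fscale g ` N"

text \<open>The product \<open>S N\<close> of \<open>\<O>\<^sub>Y\<close>-submodules: finite sums of products.\<close>

definition submodule_prod :: "'n::finite mero set \<Rightarrow> 'n mform set \<Rightarrow> 'n mform set"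
  where "submodule_prod S N =
    {(\<Sum>j<m. fscale (s j) (\<omega> j)) | (m::nat) s \<omega>. \<forall>j<m. s j \<in> S \<and> \<omega> j \<in> N}"

definition colon :: "'n::finite mform set \<Rightarrow> 'n mform set \<Rightarrow> 'n holo_germ set \<Rightarrow> 'n mform set"
  where "colon A B \<aa> = {b \<in> B. \<forall>f\<in>\<aa>. fscale (mero_of f) b \<in> A}"


section \<open>Logarithmic forms\<close>

text \<open>In the following, \<open>hs\<close> is the list \<open>h\<^sub>1, \<dots>, h\<^sub>k\<close>, with product \<open>h\<close>.\<close>

definition h_prod :: "'n::finite holo_germ list \<Rightarrow> 'n mero"
  where "h_prod hs = mero_of (prod_list hs)"

definition Sigma_C :: "'n::finite holo_germ list \<Rightarrow> 'n holo_germ set \<Rightarrow> 'n mero set"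
  where "Sigma_C hs IC = {mero_of f / h_prod hs | f. f \<in> IC}"

definition log_forms ::
    "'n::{finite,linorder} holo_germ list \<Rightarrow> 'n holo_germ set \<Rightarrow> nat \<Rightarrow> 'n mform set"
  where "log_forms hs IC q =
    {\<omega> \<in> twist (1 / h_prod hs) (holo_forms q).
      \<forall>f\<in>set hs. d_germ f \<and>\<^sub>f \<omega> \<in> submodule_prod (Sigma_C hs IC) (holo_forms (q + 1))}"

definition log_forms_rel ::
    "'n::{finite,linorder} holo_germ list \<Rightarrow> 'n holo_germ set \<Rightarrow> 'n holo_germ set \<Rightarrow> nat
      \<Rightarrow> 'n mform set"
  where "log_forms_rel hs IX IC q =
    {\<omega> \<in> twist (1 / h_prod hs) (holo_forms q).
      (\<forall>g\<in>IX. fscale (mero_of g) \<omega> \<in> submodule_prod (Sigma_C hs IC) (holo_forms q)) \<and>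
      (\<forall>g\<in>IX. d_germ g \<and>\<^sub>f \<omega> \<in> submodule_prod (Sigma_C hs IC) (holo_forms (q + 1)))}"

end

theory Submission
  imports Defs
begin

text \<open>
  The inclusion \<open>\<subseteq>\<close> holds since \<open>h\<^sub>i \<in> \<I>\<^sub>C \<subseteq> \<I>\<^sub>X\<close>. For \<open>\<supseteq>\<close>, let \<open>\<omega> \<in> \<Omega>\<^sup>q(log C)\<close> with
  \<open>\<I>\<^sub>X \<omega> \<subseteq> \<Sigma>\<Omega>\<^sup>q\<close>, let \<open>g \<in> \<I>\<^sub>X\<close> and \<open>\<eta> = dg \<and> \<omega>\<close>. By the Leibniz rule the
  condition \<open>dh\<^sub>i \<and> \<omega> \<in> \<Sigma>\<Omega>\<^bsup>q+1\<^esup>\<close> on the generators spreads to \<open>df \<and> \<omega> \<in> \<Sigma>\<Omega>\<^bsup>q+1\<^esup>\<close> for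
  every \<open>f \<in> \<I>\<^sub>C\<close>, because \<open>\<I>\<^sub>C \<omega> \<subseteq> \<Sigma>\<Omega>\<^sup>q\<close> holds for all \<open>\<omega> \<in> \<Omega>\<^sup>q(D)\<close>
  (\<open>d_ideal_wedge_log_form\<close>).

  Geometrically, \<open>X\<close> and \<open>C\<close> agree generically along \<open>X\<close>, so that the condition on \<open>dg\<close>
  follows there from the one on the \<open>dh\<^sub>i\<close>, while \<open>\<omega>\<close> itself lies in \<open>\<Sigma>\<Omega>\<^sup>q\<close> away from \<open>X\<close>.
  Algebraically, two ideals multiply \<open>\<eta>\<close> into \<open>\<Sigma>\<Omega>\<^bsup>q+1\<^esup>\<close>. For \<open>s \<in> \<I>\<^sub>X\<close> this is
  \<open>s\<eta> = dg \<and> s\<omega>\<close>. For \<open>s \<in> \<I>\<^sub>C : \<I>\<^sub>X\<close> one has \<open>sg \<in> \<I>\<^sub>C\<close> and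
  \<open>s\<eta> = d(sg) \<and> \<omega> - ds \<and> g\<omega>\<close>. A radical ideal \<open>\<I>\<^sub>C\<close> contains every \<open>f\<close> that is multiplied
  into it by both \<open>\<I>\<^sub>X\<close> and \<open>\<I>\<^sub>C : \<I>\<^sub>X\<close>: the first says \<open>f \<in> \<I>\<^sub>C : \<I>\<^sub>X\<close>, so the second
  gives \<open>f\<^sup>2 \<in> \<I>\<^sub>C\<close> (\<open>radical_ideal_colon\<close>). Applied to the coefficients of the holomorphic form \<open>h\<eta>\<close> this yields
  \<open>\<eta> \<in> \<Sigma>\<Omega>\<^bsup>q+1\<^esup>\<close> (\<open>log_forms_rel_eq_colon\<close>).

  The second equality is the first one multiplied by \<open>h \<noteq> 0\<close>, since multiplication by \<open>h\<close> is
  injective on forms and \<open>h\<Sigma> = \<I>\<^sub>C\<close>.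
\<close>


section \<open>Derivations of convergent power series\<close>

lemma multi_le_upd_Suc:
  fixes \<alpha> \<nu> :: "'n::finite \<Rightarrow> nat"
  shows "\<alpha> \<le> \<nu>(i := Suc (\<nu> i)) \<and> 0 < \<alpha> i \<longleftrightarrow> (\<exists>\<beta>\<le>\<nu>. \<alpha> = \<beta>(i := Suc (\<beta> i)))"
proof
  assume *: "\<alpha> \<le> \<nu>(i := Suc (\<nu> i)) \<and> 0 < \<alpha> i"
  have "(\<alpha>(i := \<alpha> i - 1)) j \<le> \<nu> j" for j
    using conjunct1[OF *] by (auto simp: le_fun_def dest: spec[of _ j] split: if_splits)
  then show "\<exists>\<beta>\<le>\<nu>. \<alpha> = \<beta>(i := Suc (\<beta> i))"
    using * by (intro exI[of _ "\<alpha>(i := \<alpha> i - 1)"]) (auto simp: le_fun_def)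
qed (auto simp: le_fun_def)

text \<open>Writing \<open>\<nu>\<^sub>i + 1 = \<alpha>\<^sub>i + (\<nu> + e\<^sub>i - \<alpha>)\<^sub>i\<close> in each term of the Cauchy product splits it into
  the two sums of the product rule; the terms that
  these two sums lack carry the factor \<open>0\<close>.\<close>

lemma germ_partial_mult:
  "germ_partial i (f * g) = f * germ_partial i g + germ_partial i f * g"
proof (rule holo_germ_eqI)
  fix \<nu> :: "'a \<Rightarrow> nat"
  define a where "a = germ_coeff f"
  define b where "b = germ_coeff g"
  define \<nu>' where "\<nu>' = \<nu>(i := Suc (\<nu> i))"
  have "germ_coeff (germ_partial i (f * g)) \<nu>
      = (\<Sum>\<alpha> | \<alpha> \<le> \<nu>'. of_nat (Suc (\<nu> i)) * (a \<alpha> * b (\<nu>' - \<alpha>)))"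
    by (simp add: germ_partial.rep_eq times_holo_germ.rep_eq a_def b_def \<nu>'_def sum_distrib_left
        del: of_nat_Suc)
  also have "\<dots> = (\<Sum>\<alpha> | \<alpha> \<le> \<nu>'. of_nat (\<nu>' i - \<alpha> i) * (a \<alpha> * b (\<nu>' - \<alpha>))
      + of_nat (\<alpha> i) * (a \<alpha> * b (\<nu>' - \<alpha>)))"
  proof (rule sum.cong[OF refl])
    fix \<alpha> assume "\<alpha> \<in> {\<alpha>. \<alpha> \<le> \<nu>'}"
    then have "\<alpha> i \<le> \<nu>' i" by (simp add: le_fun_def)
    then have "Suc (\<nu> i) = (\<nu>' i - \<alpha> i) + \<alpha> i" by (simp add: \<nu>'_def)
    then show "of_nat (Suc (\<nu> i)) * (a \<alpha> * b (\<nu>' - \<alpha>))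
        = of_nat (\<nu>' i - \<alpha> i) * (a \<alpha> * b (\<nu>' - \<alpha>)) + of_nat (\<alpha> i) * (a \<alpha> * b (\<nu>' - \<alpha>))"
      by (metis of_nat_add distrib_right)
  qed
  also have "\<dots> = (\<Sum>\<alpha> | \<alpha> \<le> \<nu>'. of_nat (\<nu>' i - \<alpha> i) * (a \<alpha> * b (\<nu>' - \<alpha>)))
      + (\<Sum>\<alpha> | \<alpha> \<le> \<nu>'. of_nat (\<alpha> i) * (a \<alpha> * b (\<nu>' - \<alpha>)))"
    by (rule sum.distrib)
  also have "(\<Sum>\<alpha> | \<alpha> \<le> \<nu>'. of_nat (\<nu>' i - \<alpha> i) * (a \<alpha> * b (\<nu>' - \<alpha>)))
      = (\<Sum>\<alpha> | \<alpha> \<le> \<nu>. of_nat (\<nu>' i - \<alpha> i) * (a \<alpha> * b (\<nu>' - \<alpha>)))"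
  proof (rule sum.mono_neutral_right)
    show "{\<alpha>. \<alpha> \<le> \<nu>} \<subseteq> {\<alpha>. \<alpha> \<le> \<nu>'}"
      unfolding \<nu>'_def le_fun_def by (auto intro: le_SucI)
    show "\<forall>\<alpha>\<in>{\<alpha>. \<alpha> \<le> \<nu>'} - {\<alpha>. \<alpha> \<le> \<nu>}. of_nat (\<nu>' i - \<alpha> i) * (a \<alpha> * b (\<nu>' - \<alpha>)) = 0"
    proof
      fix \<alpha> assume "\<alpha> \<in> {\<alpha>. \<alpha> \<le> \<nu>'} - {\<alpha>. \<alpha> \<le> \<nu>}"
      then have "\<alpha> \<le> \<nu>'" "\<not> \<alpha> \<le> \<nu>" by auto
      then have "\<nu>' i - \<alpha> i = 0"
        unfolding le_fun_def \<nu>'_def by (metis diff_is_0_eq fun_upd_other fun_upd_same not_less_eq_eq)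
      then show "of_nat (\<nu>' i - \<alpha> i) * (a \<alpha> * b (\<nu>' - \<alpha>)) = 0" by simp
    qed
  qed simp
  also have "\<dots> = (\<Sum>\<alpha> | \<alpha> \<le> \<nu>. a \<alpha> * germ_coeff (germ_partial i g) (\<nu> - \<alpha>))"
  proof (rule sum.cong[OF refl])
    fix \<alpha> assume "\<alpha> \<in> {\<alpha>. \<alpha> \<le> \<nu>}"
    then have le: "\<alpha> j \<le> \<nu> j" for j by (simp add: le_fun_def)
    have "\<nu>' - \<alpha> = (\<nu> - \<alpha>)(i := Suc ((\<nu> - \<alpha>) i))" "\<nu>' i - \<alpha> i = Suc ((\<nu> - \<alpha>) i)"
      using le by (auto simp: \<nu>'_def fun_eq_iff Suc_diff_le)
    then show "of_nat (\<nu>' i - \<alpha> i) * (a \<alpha> * b (\<nu>' - \<alpha>))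
        = a \<alpha> * germ_coeff (germ_partial i g) (\<nu> - \<alpha>)"
      by (simp add: germ_partial.rep_eq b_def algebra_simps)
  qed
  also have "(\<Sum>\<alpha> | \<alpha> \<le> \<nu>'. of_nat (\<alpha> i) * (a \<alpha> * b (\<nu>' - \<alpha>)))
      = (\<Sum>\<alpha>\<in>(\<lambda>\<beta>. \<beta>(i := Suc (\<beta> i))) ` {\<beta>. \<beta> \<le> \<nu>}. of_nat (\<alpha> i) * (a \<alpha> * b (\<nu>' - \<alpha>)))"
    using multi_le_upd_Suc[of _ \<nu> i, folded \<nu>'_def]
    by (intro sum.mono_neutral_right) auto
  also have "\<dots> = (\<Sum>\<beta> | \<beta> \<le> \<nu>. germ_coeff (germ_partial i f) \<beta> * b (\<nu> - \<beta>))"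
  proof -
    have "inj_on (\<lambda>\<beta>. \<beta>(i := Suc (\<beta> i))) {\<beta>. \<beta> \<le> \<nu>}"
      by (rule inj_onI) (metis fun_upd_same fun_upd_triv fun_upd_upd nat.inject)
    have "\<nu>' - \<beta>(i := Suc (\<beta> i)) = \<nu> - \<beta>" for \<beta>
      by (auto simp: \<nu>'_def fun_eq_iff)
    with \<open>inj_on _ _\<close> show ?thesis
      by (simp add: sum.reindex germ_partial.rep_eq a_def mult.assoc)
  qed
  finally show "germ_coeff (germ_partial i (f * g)) \<nu>
      = germ_coeff (f * germ_partial i g + germ_partial i f * g) \<nu>"
    by (simp only: plus_holo_germ.rep_eq times_holo_germ.rep_eq a_def b_def)
qed

lemma germ_partial_add: "germ_partial i (f + g) = germ_partial i f + germ_partial i g"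
  by (rule holo_germ_eqI) (simp add: germ_partial.rep_eq plus_holo_germ.rep_eq distrib_left)

lemma germ_partial_0: "germ_partial i 0 = 0"
  by (rule holo_germ_eqI) (simp add: germ_partial.rep_eq zero_holo_germ.rep_eq)


section \<open>Submodules of the field of fractions and forms with coefficients in them\<close>

lemma mero_of_add: "mero_of (f + g) = mero_of f + mero_of g"
  by (simp add: mero_of_def)

lemma mero_of_mult: "mero_of (f * g) = mero_of f * mero_of g"
  by (simp add: mero_of_def)

lemma mero_of_0 [simp]: "mero_of 0 = 0"
  by (simp add: mero_of_def Zero_fract_def)

lemma mero_of_1 [simp]: "mero_of 1 = 1"
  by (simp add: mero_of_def One_fract_def)

lemma mero_of_eq_iff [simp]: "mero_of f = mero_of g \<longleftrightarrow> f = g"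
  by (simp add: mero_of_def eq_fract)

definition mero_submodule :: "'n::finite mero set \<Rightarrow> bool"
  where "mero_submodule S \<longleftrightarrow>
    0 \<in> S \<and> (\<forall>x\<in>S. \<forall>y\<in>S. x + y \<in> S) \<and> (\<forall>f. \<forall>x\<in>S. mero_of f * x \<in> S)"

lemma mero_submodule_minus:
  assumes "mero_submodule S" "x \<in> S"
  shows "- x \<in> S"
proof -
  have "mero_of (- 1) = - 1"
    using mero_of_add[of "- 1" 1] by (simp add: eq_neg_iff_add_eq_0)
  then show ?thesis using assms unfolding mero_submodule_def by (metis mult_minus1)
qed

lemma mero_submodule_sum:
  assumes "mero_submodule S" "\<And>x. x \<in> A \<Longrightarrow> f x \<in> S"
  shows "sum f A \<in> S"
  using assms(2)
  by (induction A rule: infinite_finite_induct)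
    (use assms(1) in \<open>auto simp: mero_submodule_def\<close>)

lemma mero_submodule_ideal_quotient:
  assumes "is_ideal I"
  shows "mero_submodule {mero_of f / c | f. f \<in> I}"
proof -
  have "\<exists>f'. mero_of f / c + mero_of g / c = mero_of f' / c \<and> f' \<in> I" if "f \<in> I" "g \<in> I" for f g
    using that ring_ideal.subspace_add[OF assms]
    by (intro exI[of _ "f + g"]) (simp add: mero_of_add add_divide_distrib)
  moreover have "\<exists>f'. mero_of g * (mero_of f / c) = mero_of f' / c \<and> f' \<in> I" if "f \<in> I" for f g
    using that ring_ideal.subspace_scale[OF assms]
    by (intro exI[of _ "g * f"]) (simp add: mero_of_mult)
  moreover have "\<exists>f. 0 = mero_of f / c \<and> f \<in> I"
    using ring_ideal.subspace_0[OF assms] by (intro exI[of _ 0]) simp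
  ultimately show ?thesis unfolding mero_submodule_def by blast
qed

lemma mero_submodule_image:
  assumes "is_ideal I"
  shows "mero_submodule (mero_of ` I)"
proof -
  have "mero_of ` I = {mero_of f / 1 | f. f \<in> I}" by auto
  then show ?thesis using mero_submodule_ideal_quotient[OF assms, of 1] by simp
qed

definition forms_with_coeffs :: "'n::finite mero set \<Rightarrow> nat \<Rightarrow> 'n mform set"
  where "forms_with_coeffs S q = {\<omega>. \<forall>I. \<omega> I \<in> S \<and> (card I \<noteq> q \<longrightarrow> \<omega> I = 0)}"

lemma forms_with_coeffs_add:
  assumes "mero_submodule S" "\<omega> \<in> forms_with_coeffs S q" "\<eta> \<in> forms_with_coeffs S q"
  shows "\<omega> + \<eta> \<in> forms_with_coeffs S q"
  using assms by (auto simp: forms_with_coeffs_def mero_submodule_def)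

lemma forms_with_coeffs_sum:
  assumes "mero_submodule S" "\<And>x. x \<in> A \<Longrightarrow> \<omega> x \<in> forms_with_coeffs S q"
  shows "sum \<omega> A \<in> forms_with_coeffs S q"
  using assms(2)
proof (induction A rule: infinite_finite_induct)
  case (insert x A)
  then have "\<omega> x + sum \<omega> A \<in> forms_with_coeffs S q"
    using forms_with_coeffs_add[OF assms(1)] by blast
  then show ?case by (simp only: sum.insert[OF insert.hyps])
qed (use assms(1) in \<open>auto simp: forms_with_coeffs_def mero_submodule_def\<close>)

lemma forms_with_coeffs_diff:
  assumes "mero_submodule S" "\<omega> \<in> forms_with_coeffs S q" "\<eta> \<in> forms_with_coeffs S q"
  shows "\<omega> - \<eta> \<in> forms_with_coeffs S q"
  using forms_with_coeffs_add[OF assms(1,2), of "- \<eta>"] assms(3) mero_submodule_minus[OF assms(1)]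
  by (auto simp: forms_with_coeffs_def)

lemma forms_with_coeffs_scale:
  assumes "mero_submodule S" "\<omega> \<in> forms_with_coeffs S q"
  shows "fscale (mero_of f) \<omega> \<in> forms_with_coeffs S q"
  using assms by (auto simp: forms_with_coeffs_def mero_submodule_def fscale_def)

lemma twist_forms_with_coeffs:
  "c \<noteq> 0 \<Longrightarrow> twist c (forms_with_coeffs S q) = forms_with_coeffs ((*) c ` S) q"
proof safe
  fix \<omega> assume "c \<noteq> 0" "\<omega> \<in> twist c (forms_with_coeffs S q)"
  then show "\<omega> \<in> forms_with_coeffs ((*) c ` S) q"
    by (auto simp: twist_def forms_with_coeffs_def fscale_def)
next
  fix \<omega> assume c: "c \<noteq> 0" and \<omega>: "\<omega> \<in> forms_with_coeffs ((*) c ` S) q"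
  have "\<omega> I / c \<in> S" for I
  proof -
    obtain s where "s \<in> S" "\<omega> I = c * s" using \<omega> by (auto simp: forms_with_coeffs_def)
    then show ?thesis using c by simp
  qed
  then have "fscale (1 / c) \<omega> \<in> forms_with_coeffs S q"
    using \<omega> by (auto simp: forms_with_coeffs_def fscale_def)
  moreover have "\<omega> = fscale c (fscale (1 / c) \<omega>)" using c by (simp add: fscale_def)
  ultimately show "\<omega> \<in> twist c (forms_with_coeffs S q)" unfolding twist_def by blast
qed

lemma sum_form_apply: "(\<Sum>x\<in>A. \<omega> x :: 'n::finite mform) I = (\<Sum>x\<in>A. \<omega> x I)"
  by (induction A rule: infinite_finite_induct) auto

lemma holo_forms_eq: "holo_forms q = forms_with_coeffs (range mero_of) q"
  by (auto simp: holo_forms_def forms_with_coeffs_def)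

text \<open>\<open>\<Omega>\<^sup>q\<close> is free on the \<open>dx\<^sub>I\<close> with \<open>\<bar>I\<bar> = q\<close>, so membership in \<open>S \<Omega>\<^sup>q\<close> can be tested on
  coefficients.\<close>

lemma submodule_prod_holo_forms:
  fixes S :: "'n::finite mero set"
  assumes S: "mero_submodule S"
  shows "submodule_prod S (holo_forms q) = forms_with_coeffs S q"
proof safe
  fix \<omega> assume "\<omega> \<in> submodule_prod S (holo_forms q)"
  then obtain m s \<eta> where \<omega>: "\<omega> = (\<Sum>j<(m::nat). fscale (s j) (\<eta> j))"
    and s: "\<And>j. j < m \<Longrightarrow> s j \<in> S" and \<eta>: "\<And>j. j < m \<Longrightarrow> \<eta> j \<in> holo_forms q"
    by (auto simp: submodule_prod_def)
  have "fscale (s j) (\<eta> j) \<in> forms_with_coeffs S q" if "j < m" for j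
  proof -
    have "s j * \<eta> j I \<in> S" for I
    proof -
      obtain f where "\<eta> j I = mero_of f" using \<eta>[OF \<open>j < m\<close>] by (auto simp: holo_forms_def)
      then show ?thesis
        using S s[OF \<open>j < m\<close>] by (auto simp: mero_submodule_def mult.commute[of "s j"])
    qed
    then show ?thesis using \<eta>[OF that] by (auto simp: forms_with_coeffs_def holo_forms_def fscale_def)
  qed
  then show "\<omega> \<in> forms_with_coeffs S q"
    unfolding \<omega> by (intro forms_with_coeffs_sum[OF S]) simp
next
  fix \<omega> assume \<omega>: "\<omega> \<in> forms_with_coeffs S q"
  obtain e where e: "bij_betw e {..<card {I::'n set. card I = q}} {I::'n set. card I = q}"
    using ex_bij_betw_nat_finite[of "{I::'n set. card I = q}"] by (auto simp: atLeast0LessThan)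
  have "(\<Sum>j<card {I::'n set. card I = q}. fscale (\<omega> (e j)) (dx (e j)))
      = (\<Sum>I | card I = q. fscale (\<omega> I) (dx I))"
    using sum.reindex_bij_betw[OF e] by simp
  also have "\<dots> = \<omega>"
  proof
    fix J
    have "(\<Sum>I | card I = q. fscale (\<omega> I) (dx I)) J = (\<Sum>I | card I = q. if J = I then \<omega> I else 0)"
      by (simp add: sum_form_apply fscale_def dx_def if_distrib cong: if_cong)
    then show "(\<Sum>I | card I = q. fscale (\<omega> I) (dx I)) J = \<omega> J"
      using \<omega> by (simp add: forms_with_coeffs_def)
  qed
  finally have *: "\<omega> = (\<Sum>j<card {I::'n set. card I = q}. fscale (\<omega> (e j)) (dx (e j)))" ..
  have "dx I \<in> holo_forms q" if "card I = q" for I :: "'n set"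
  proof -
    have "(1::'n mero) \<in> range mero_of" "(0::'n mero) \<in> range mero_of"
      by (metis mero_of_1 rangeI, metis mero_of_0 rangeI)
    then show ?thesis using that by (auto simp: holo_forms_def dx_def)
  qed
  moreover have "card (e j) = q" if "j < card {I::'n set. card I = q}" for j
    using bij_betwE[OF e] that by auto
  ultimately show "\<omega> \<in> submodule_prod S (holo_forms q)"
    unfolding submodule_prod_def using * \<omega>
    by (auto simp: forms_with_coeffs_def intro!: exI[of _ "\<lambda>j. \<omega> (e j)"] exI[of _ "\<lambda>j. dx (e j)"])
qed


section \<open>Exterior derivatives and wedge products\<close>

lemma d_germ_apply: "d_germ f I = (\<Sum>i\<in>UNIV. if I = {i} then mero_of (germ_partial i f) else 0)"
  by (simp add: d_germ_def sum_form_apply fscale_def dx_def if_distrib cong: if_cong)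

lemma d_germ_add: "d_germ (f + g) = d_germ f + d_germ g"
  by (auto simp: fun_eq_iff d_germ_apply germ_partial_add mero_of_add sum.distrib[symmetric]
      intro!: sum.cong)

lemma d_germ_0: "d_germ 0 = 0"
  by (auto simp: fun_eq_iff d_germ_apply germ_partial_0 intro!: sum.neutral)

lemma d_germ_mult: "d_germ (f * g) = fscale (mero_of f) (d_germ g) + fscale (mero_of g) (d_germ f)"
  by (auto simp: fun_eq_iff d_germ_apply fscale_def germ_partial_mult mero_of_add mero_of_mult
      sum_distrib_left sum.distrib[symmetric] mult.commute intro!: sum.cong)

lemma d_germ_holo: "d_germ f \<in> holo_forms 1"
proof -
  have "mero_submodule (range (mero_of :: 'a holo_germ \<Rightarrow> _))"
    by (rule mero_submodule_image) (rule ring_ideal.subspace_UNIV)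
  then have "d_germ f I \<in> range mero_of" for I
    unfolding d_germ_apply by (rule mero_submodule_sum) (auto intro: range_eqI[of _ _ 0])
  then show ?thesis
    unfolding holo_forms_def by (auto simp: d_germ_apply intro!: sum.neutral)
qed

lemma wedge_add_left: "(\<alpha> + \<beta>) \<and>\<^sub>f \<omega> = (\<alpha> \<and>\<^sub>f \<omega>) + (\<beta> \<and>\<^sub>f \<omega>)"
  by (simp add: wedge_def fun_eq_iff algebra_simps sum.distrib)

lemma wedge_scale_left: "fscale c \<alpha> \<and>\<^sub>f \<omega> = fscale c (\<alpha> \<and>\<^sub>f \<omega>)"
  by (simp add: wedge_def fun_eq_iff fscale_def sum_distrib_left mult_ac)

lemma wedge_scale_right: "\<alpha> \<and>\<^sub>f fscale c \<omega> = fscale c (\<alpha> \<and>\<^sub>f \<omega>)"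
  by (simp add: wedge_def fun_eq_iff fscale_def sum_distrib_left mult_ac)

lemma wedge_forms_with_coeffs:
  fixes \<alpha> :: "'n::{finite,linorder} mform"
  assumes S: "mero_submodule S" and \<alpha>: "\<alpha> \<in> holo_forms p" and \<omega>: "\<omega> \<in> forms_with_coeffs S q"
  shows "\<alpha> \<and>\<^sub>f \<omega> \<in> forms_with_coeffs S (p + q)"
proof -
  have "(\<alpha> \<and>\<^sub>f \<omega>) K \<in> S" for K
    unfolding wedge_def
  proof (rule mero_submodule_sum[OF S])
    fix I
    obtain f where "\<alpha> I = mero_of f" using \<alpha> by (auto simp: holo_forms_def)
    then have "\<alpha> I * \<omega> (K - I) \<in> S"
      using S \<omega> by (auto simp: forms_with_coeffs_def mero_submodule_def)
    moreover have "wedge_sign I (K - I) = (1::'n mero) \<or> wedge_sign I (K - I) = (- 1::'n mero)"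
      unfolding wedge_sign_def using neg_one_even_power neg_one_odd_power by blast
    ultimately show "wedge_sign I (K - I) * \<alpha> I * \<omega> (K - I) \<in> S"
      using mero_submodule_minus[OF S] by (auto simp: mult.assoc)
  qed
  moreover have "(\<alpha> \<and>\<^sub>f \<omega>) K = 0" if "card K \<noteq> p + q" for K
    unfolding wedge_def
  proof (rule sum.neutral, rule ballI)
    fix I assume "I \<in> Pow K"
    then have "card I + card (K - I) = card K"
      by (simp add: card_Diff_subset card_mono)
    then have "card I \<noteq> p \<or> card (K - I) \<noteq> q" using that by auto
    then show "wedge_sign I (K - I) * \<alpha> I * \<omega> (K - I) = 0"
      using \<alpha> \<omega> by (auto simp: holo_forms_def forms_with_coeffs_def)
  qed
  ultimately show ?thesis by (simp add: forms_with_coeffs_def)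
qed

lemma wedge_d_germ:
  assumes "mero_submodule S" "\<omega> \<in> forms_with_coeffs S q"
  shows "d_germ f \<and>\<^sub>f \<omega> \<in> forms_with_coeffs S (q + 1)"
  using wedge_forms_with_coeffs[OF assms(1) d_germ_holo assms(2)] by simp


section \<open>Comparison of the logarithmic conditions along \<open>X\<close> and \<open>C\<close>\<close>

text \<open>The hypotheses put \<open>f\<close> into \<open>I : J\<close> and then \<open>f\<^sup>2\<close> into \<open>I\<close>. In geometric terms, \<open>J + (I : J)\<close>
  vanishes on no component of the zero set of \<open>I\<close>.\<close>

lemma radical_ideal_colon:
  fixes I J :: "'a::comm_ring_1 set"
  assumes radical: "\<And>f m. f ^ m \<in> I \<Longrightarrow> f \<in> I"
    and "\<And>s. s \<in> J \<Longrightarrow> s * f \<in> I"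
    and "\<And>s. (\<And>g. g \<in> J \<Longrightarrow> s * g \<in> I) \<Longrightarrow> s * f \<in> I"
  shows "f \<in> I"
proof -
  have "f * f \<in> I" using assms(2,3) by (metis mult.commute)
  then show ?thesis by (intro radical[of f 2]) (simp add: power2_eq_square)
qed

text \<open>A zero entry of a regular sequence would force \<open>1\<close> into the ideal of its predecessors. This
  makes division by \<open>h\<close> meaningful.\<close>

lemma regular_seq_prod_nonzero:
  fixes hs :: "'a::idom list"
  assumes "regular_seq hs"
  shows "prod_list hs \<noteq> 0"
proof
  assume "prod_list hs = 0"
  then have "0 \<in> set hs" by (simp add: prod_list_zero_iff)
  then obtain i where i: "i < length hs" "hs ! i = 0" by (auto simp: in_set_conv_nth)
  define I where "I = ideal_gen ({0} \<union> set (take i hs))"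
  have "hs ! i * 1 \<in> I" using i by (simp add: I_def ring_ideal.span_zero)
  then have "1 \<in> I" using assms i(1) unfolding regular_seq_def regular_seq_quot_def I_def by blast
  then have "1 \<in> ideal_gen ({0} \<union> set hs)"
    unfolding I_def using ring_ideal.span_mono[of "{0} \<union> set (take i hs)" "{0} \<union> set hs"]
      set_take_subset[of i hs] by blast
  then have "ideal_gen ({0} \<union> set hs) = UNIV"
    using ring_ideal.span_scale[of 1 "{0} \<union> set hs"] by force
  then show False using assms by (simp add: regular_seq_def regular_seq_quot_def)
qed

lemma Sigma_C_submodule: "is_ideal IC \<Longrightarrow> mero_submodule (Sigma_C hs IC)"
  unfolding Sigma_C_def by (rule mero_submodule_ideal_quotient)

lemma twist_inverse_holo_forms:
  assumes "h \<noteq> 0" "\<omega> \<in> twist (1 / h) (holo_forms q)"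
  shows "\<omega> \<in> forms_with_coeffs {mero_of f / h | f. f \<in> UNIV} q"
proof -
  have "(*) (1 / h) ` range mero_of = {mero_of f / h | f. f \<in> UNIV}" by auto
  then show ?thesis
    using assms twist_forms_with_coeffs[of "1 / h" "range mero_of" q] by (simp add: holo_forms_eq)
qed

lemma ideal_times_polar_form:
  assumes "h_prod hs \<noteq> 0" "is_ideal IC" "f \<in> IC" "\<omega> \<in> twist (1 / h_prod hs) (holo_forms q)"
  shows "fscale (mero_of f) \<omega> \<in> forms_with_coeffs (Sigma_C hs IC) q"
proof -
  have \<omega>: "\<omega> \<in> forms_with_coeffs {mero_of g / h_prod hs | g. g \<in> UNIV} q"
    by (rule twist_inverse_holo_forms[OF assms(1,4)])
  have "mero_of f * \<omega> I \<in> Sigma_C hs IC" for I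
  proof -
    obtain g where "\<omega> I = mero_of g / h_prod hs" using \<omega> by (auto simp: forms_with_coeffs_def)
    moreover have "g * f \<in> IC" using ring_ideal.subspace_scale[OF assms(2,3)] .
    ultimately show ?thesis
      unfolding Sigma_C_def by (auto simp: mero_of_mult mult.commute intro!: exI[of _ "g * f"])
  qed
  then show ?thesis using \<omega> by (auto simp: forms_with_coeffs_def fscale_def)
qed

text \<open>The submodule \<open>\<Omega>\<^sup>q(log C)\<close> does not depend on the generators: the error term \<open>f da \<and> \<omega>\<close> in
  \<open>d(af) \<and> \<omega>\<close> is harmless since \<open>f\<omega> \<in> \<Sigma>\<Omega>\<^sup>q\<close>.\<close>

lemma d_ideal_wedge_log_form:
  fixes hs :: "'n::{finite,linorder} holo_germ list"
  assumes h: "h_prod hs \<noteq> 0" and gen: "ideal_gen (set hs) = IC"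
    and \<omega>: "\<omega> \<in> log_forms hs IC q" and f: "f \<in> IC"
  shows "d_germ f \<and>\<^sub>f \<omega> \<in> forms_with_coeffs (Sigma_C hs IC) (q + 1)"
proof -
  have ideal: "is_ideal IC" using gen ring_ideal.subspace_span by blast
  note S = Sigma_C_submodule[OF ideal, of hs]
  have pole: "\<omega> \<in> twist (1 / h_prod hs) (holo_forms q)"
    and log: "\<And>f. f \<in> set hs \<Longrightarrow> d_germ f \<and>\<^sub>f \<omega> \<in> forms_with_coeffs (Sigma_C hs IC) (q + 1)"
    using \<omega> by (auto simp: log_forms_def submodule_prod_holo_forms[OF S])
  define L where "L = {f \<in> IC. d_germ f \<and>\<^sub>f \<omega> \<in> forms_with_coeffs (Sigma_C hs IC) (q + 1)}"
  have "is_ideal L"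
  proof (rule ring_ideal.subspaceI)
    have "(0 :: 'n mform) \<and>\<^sub>f \<omega> = 0" by (simp add: wedge_def fun_eq_iff)
    then show "0 \<in> L"
      using S ring_ideal.subspace_0[OF ideal]
      by (simp add: L_def d_germ_0 forms_with_coeffs_def mero_submodule_def)
  next
    fix f g assume "f \<in> L" "g \<in> L"
    then show "f + g \<in> L"
      using ring_ideal.subspace_add[OF ideal] forms_with_coeffs_add[OF S]
      by (auto simp: L_def d_germ_add wedge_add_left)
  next
    fix a f assume "f \<in> L"
    then have f: "f \<in> IC" "d_germ f \<and>\<^sub>f \<omega> \<in> forms_with_coeffs (Sigma_C hs IC) (q + 1)"
      by (auto simp: L_def)
    have "d_germ (a * f) \<and>\<^sub>f \<omega>
        = fscale (mero_of a) (d_germ f \<and>\<^sub>f \<omega>) + (d_germ a \<and>\<^sub>f fscale (mero_of f) \<omega>)"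
      by (simp add: d_germ_mult wedge_add_left wedge_scale_left wedge_scale_right)
    also have "\<dots> \<in> forms_with_coeffs (Sigma_C hs IC) (q + 1)"
      by (intro forms_with_coeffs_add[OF S] forms_with_coeffs_scale[OF S] f(2) wedge_d_germ[OF S]
          ideal_times_polar_form[OF h ideal f(1) pole])
    finally show "a * f \<in> L"
      using ring_ideal.subspace_scale[OF ideal f(1)] by (simp add: L_def)
  qed
  moreover have "set hs \<subseteq> L"
    using log gen ring_ideal.span_superset[of "set hs"] by (auto simp: L_def)
  ultimately have "ideal_gen (set hs) \<subseteq> L" by (intro ring_ideal.span_minimal)
  then show ?thesis using f gen by (auto simp: L_def)
qed

lemma log_forms_rel_eq_colon:
  fixes IX IC :: "'n::{finite,linorder} holo_germ set"
  assumes h: "h_prod hs \<noteq> 0" and gen: "ideal_gen (set hs) = IC"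
    and radical: "\<And>f m. f ^ m \<in> IC \<Longrightarrow> f \<in> IC" and sub: "IC \<subseteq> IX"
  shows "log_forms_rel hs IX IC q
      = colon (submodule_prod (Sigma_C hs IC) (holo_forms q)) (log_forms hs IC q) IX"
proof (intro equalityI subsetI)
  fix \<omega> assume "\<omega> \<in> log_forms_rel hs IX IC q"
  moreover have "set hs \<subseteq> IX" using gen sub ring_ideal.span_superset by blast
  ultimately show "\<omega> \<in> colon (submodule_prod (Sigma_C hs IC) (holo_forms q)) (log_forms hs IC q) IX"
    by (auto simp: log_forms_rel_def colon_def log_forms_def)
next
  have ideal: "is_ideal IC" using gen ring_ideal.subspace_span by blast
  note S = Sigma_C_submodule[OF ideal, of hs]
  fix \<omega> assume "\<omega> \<in> colon (submodule_prod (Sigma_C hs IC) (holo_forms q)) (log_forms hs IC q) IX"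
  then have \<omega>: "\<omega> \<in> log_forms hs IC q" and pole: "\<omega> \<in> twist (1 / h_prod hs) (holo_forms q)"
    and ann: "\<And>g. g \<in> IX \<Longrightarrow> fscale (mero_of g) \<omega> \<in> forms_with_coeffs (Sigma_C hs IC) q"
    by (auto simp: colon_def log_forms_def submodule_prod_holo_forms[OF S])
  have "d_germ g \<and>\<^sub>f \<omega> \<in> forms_with_coeffs (Sigma_C hs IC) (q + 1)" if g: "g \<in> IX" for g
  proof -
    define \<eta> where "\<eta> = d_germ g \<and>\<^sub>f \<omega>"
    have "\<eta> \<in> forms_with_coeffs {mero_of f / h_prod hs | f. f \<in> UNIV} (q + 1)"
      unfolding \<eta>_def
      by (intro wedge_d_germ mero_submodule_ideal_quotient ring_ideal.subspace_UNIV
          twist_inverse_holo_forms[OF h pole])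
    then have polar: "\<exists>f. \<eta> K = mero_of f / h_prod hs" "card K \<noteq> q + 1 \<Longrightarrow> \<eta> K = 0" for K
      by (auto simp: forms_with_coeffs_def)
    have by_IX: "fscale (mero_of s) \<eta> \<in> forms_with_coeffs (Sigma_C hs IC) (q + 1)" if "s \<in> IX" for s
      using wedge_d_germ[OF S ann[OF that], of g] by (simp add: \<eta>_def wedge_scale_right)
    have by_colon: "fscale (mero_of s) \<eta> \<in> forms_with_coeffs (Sigma_C hs IC) (q + 1)"
      if "\<And>g. g \<in> IX \<Longrightarrow> s * g \<in> IC" for s
    proof -
      have "fscale (mero_of s) \<eta>
          = (d_germ (s * g) \<and>\<^sub>f \<omega>) - (d_germ s \<and>\<^sub>f fscale (mero_of g) \<omega>)"
        by (simp add: \<eta>_def d_germ_mult wedge_add_left wedge_scale_left wedge_scale_right)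
      also have "\<dots> \<in> forms_with_coeffs (Sigma_C hs IC) (q + 1)"
        by (intro forms_with_coeffs_diff[OF S] wedge_d_germ[OF S] ann[OF g]
            d_ideal_wedge_log_form[OF h gen \<omega>] that[OF g])
      finally show ?thesis .
    qed
    have "\<eta> K \<in> Sigma_C hs IC" for K
    proof -
      obtain f where f: "\<eta> K = mero_of f / h_prod hs" using polar(1) by blast
      have cancel: "s * f \<in> IC"
        if "fscale (mero_of s) \<eta> \<in> forms_with_coeffs (Sigma_C hs IC) (q + 1)" for s
      proof -
        have "mero_of s * \<eta> K \<in> Sigma_C hs IC"
          using that by (auto simp: forms_with_coeffs_def fscale_def)
        then obtain f' where "f' \<in> IC" "mero_of s * (mero_of f / h_prod hs) = mero_of f' / h_prod hs"
          by (auto simp: Sigma_C_def f)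
        then show ?thesis using h by (simp flip: mero_of_mult)
      qed
      have "f \<in> IC"
        by (rule radical_ideal_colon[OF radical, of _ IX]) (auto intro: cancel by_IX by_colon)
      then show ?thesis using f by (auto simp: Sigma_C_def)
    qed
    then show ?thesis using polar(2) unfolding \<eta>_def[symmetric] forms_with_coeffs_def by blast
  qed
  then show "\<omega> \<in> log_forms_rel hs IX IC q"
    using pole ann by (auto simp: log_forms_rel_def submodule_prod_holo_forms[OF S])
qed

lemma twist_colon:
  assumes "c \<noteq> 0"
  shows "twist c (colon A B J) = colon (twist c A) (twist c B) J"
proof -
  have comm: "fscale (mero_of f) (fscale c \<omega>) = fscale c (fscale (mero_of f) \<omega>)" for f \<omega>
    by (simp add: fscale_def mult.left_commute)
  have "inj (fscale c)"
  proof (rule injI)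
    fix \<omega> \<eta> :: "'a mform" assume "fscale c \<omega> = fscale c \<eta>"
    then show "\<omega> = \<eta>" using assms by (simp add: fscale_def fun_eq_iff)
  qed
  then show ?thesis
    by (auto simp: twist_def colon_def comm inj_image_mem_iff)
qed

lemma twist_Sigma_forms:
  assumes "h_prod hs \<noteq> 0" "is_ideal IC"
  shows "twist (h_prod hs) (submodule_prod (Sigma_C hs IC) (holo_forms q))
      = submodule_prod (mero_of ` IC) (holo_forms q)"
proof -
  have "(*) (h_prod hs) ` Sigma_C hs IC = mero_of ` IC"
    using assms(1) by (force simp: Sigma_C_def image_iff)
  then show ?thesis
    by (simp add: submodule_prod_holo_forms Sigma_C_submodule[OF assms(2)]
        mero_submodule_image[OF assms(2)] twist_forms_with_coeffs[OF assms(1)])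
qed

theorem lemma3p15:
  fixes IX IC :: "'n::{finite,linorder} holo_germ set"
    and hs :: "'n holo_germ list"
    and k q :: nat
  assumes "k \<ge> 2"
    and "reduced_germ IX" and "cohen_macaulay_germ IX" and "germ_codim IX = enat k"
    and "reduced_germ IC" and "germ_codim IC = enat k"
    and "regular_seq hs" and "length hs = k" and "ideal_gen (set hs) = IC"
    and "IC \<subseteq> IX"
  shows "log_forms_rel hs IX IC q
      = colon (submodule_prod (Sigma_C hs IC) (holo_forms q)) (log_forms hs IC q) IX
    \<and> twist (h_prod hs) (log_forms_rel hs IX IC q)
      = colon (submodule_prod (mero_of ` IC) (holo_forms q))
          (twist (h_prod hs) (log_forms hs IC q)) IX"
proof -
  have ideal: "is_ideal IC" and radical: "\<And>f m. f ^ m \<in> IC \<Longrightarrow> f \<in> IC"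
    using \<open>reduced_germ IC\<close> by (auto simp: reduced_germ_def is_germ_def)
  have h: "h_prod hs \<noteq> 0"
    using regular_seq_prod_nonzero[OF \<open>regular_seq hs\<close>] mero_of_eq_iff[of "prod_list hs" 0]
    by (simp add: h_prod_def)
  note eq = log_forms_rel_eq_colon[OF h \<open>ideal_gen (set hs) = IC\<close> radical \<open>IC \<subseteq> IX\<close>]
  show ?thesis
    using eq twist_colon[OF h] twist_Sigma_forms[OF h ideal] by simp
qed

end
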